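(* Let $R$ be a commutative local ring with identity. Then $R$ is an MTL-ring if and only if the set $Id(R)$ of ideals of $R$ is a chain under inclusion $\subseteq$.
   Context: For ideals $I,J$ of a commutative ring $R$, write $I\rightarrow J=\{x\in R : xI\subseteq J\}$. A commutative ring $R$ such that for every $x\in R$ there is $r\in R$ with $x=rx$ (automatic if $R$ has an identity) is called an MTL-ring if $(I\rightarrow J)+(J\rightarrow I)=R$ for all ideals $I,J$ of $R$. A local ring is a ring with a unique maximal ideal (not assumed noetherian). *)

theory Defs
  imports "HOL-Algebra.Ideal" "HOL-Algebra.AbelCoset"
begin

definition ideal_imp :: "('a, 'b) ring_scheme \<Rightarrow> 'a set \<Rightarrow> 'a set \<Rightarrow> 'a set" where
  "ideal_imp R I J = {x \<in> carrier R. x <#\<^bsub>R\<^esub> I \<subseteq> J}"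

definition ideals :: "('a, 'b) ring_scheme \<Rightarrow> 'a set set" where
  "ideals R = {I. ideal I R}"

(* The notion is stated in the literature for commutative rings that need not have an
   identity. Rings in HOL-Algebra are unital, so mtl_unital is automatic here; it is kept so
   that the definition reads as in the source. *)
locale mtl_ring = cring +
  assumes mtl_unital: "x \<in> carrier R \<Longrightarrow> \<exists>r\<in>carrier R. x = r \<otimes> x"
    and mtl_prelinear:
      "\<lbrakk>I \<in> ideals R; J \<in> ideals R\<rbrakk> \<Longrightarrow> ideal_imp R I J <+> ideal_imp R J I = carrier R"

(* No chain condition is imposed. The zero ring has no maximal ideal, so it is not local. *)
locale local_cring = cring +
  assumes unique_maximal_ideal: "\<exists>!M. maximalideal M R"

end

theory Submission
  imports Defs "HOL-Algebra.Ring_Divisibility"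
begin

text \<open>In a local ring a sum of two proper ideals lies in the maximal ideal and so is proper. Hence
  (I \<rightarrow> J) + (J \<rightarrow> I) = R forces one of the two summands to be R, which says I \<subseteq> J or
  J \<subseteq> I. Conversely, if I \<subseteq> J then I \<rightarrow> J is already R.\<close>

text \<open>Zorn's lemma, applied to the ideals above \<open>I\<close> that avoid
  \<open>\<one>\<close>. Writing properness as \<open>\<one> \<notin> J\<close> makes it visibly
  survive unions of chains.\<close>

lemma (in ring) proper_ideal_in_maximalideal:
  assumes "ideal I R" "\<one> \<notin> I"
  obtains M where "maximalideal M R" "I \<subseteq> M"
proof -
  define \<A> where "\<A> = {J. ideal J R \<and> I \<subseteq> J \<and> \<one> \<notin> J}"
  have "\<exists>M\<in>\<A>. \<forall>X\<in>\<A>. M \<subseteq> X \<longrightarrow> X = M"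
  proof (rule subset_Zorn_nonempty)
    show "\<A> \<noteq> {}"
      using assms by (auto simp: \<A>_def)
  next
    fix C assume C: "C \<noteq> {}" "subset.chain \<A> C"
    then have sub: "C \<subseteq> \<A>" and "subset.chain {J. ideal J R} C"
      unfolding \<A>_def pred_on.chain_def by blast+
    \<comment> \<open>Nonemptiness of \<open>C\<close> selects the union in
      \<open>chain_Union_is_ideal\<close>, whose empty case is the zero ideal; below it also gives
      \<open>I \<subseteq> \<Union>C\<close>.\<close>
    with C(1) have "ideal (\<Union>C) R"
      using chain_Union_is_ideal[of C] by simp
    with C(1) sub show "\<Union>C \<in> \<A>"
      unfolding \<A>_def by blast
  qed
  then obtain M where "M \<in> \<A>" and max: "\<And>J. \<lbrakk>J \<in> \<A>; M \<subseteq> J\<rbrakk> \<Longrightarrow> J = M"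
    by blast
  then have M: "ideal M R" "I \<subseteq> M" "\<one> \<notin> M"
    by (simp_all add: \<A>_def)
  have "maximalideal M R"
  proof (rule maximalidealI[OF M(1)])
    show "carrier R \<noteq> M"
      using M(3) by auto
  next
    fix J assume J: "ideal J R" "M \<subseteq> J"
    show "J = M \<or> J = carrier R"
    proof (cases "\<one> \<in> J")
      case True
      then show ?thesis
        using ideal.one_imp_carrier[OF J(1)] by blast
    next
      case False
      then have "J \<in> \<A>"
        using J M(2) by (auto simp: \<A>_def)
      then show ?thesis
        using max J(2) by blast
    qed
  qed
  then show thesis
    using M(2) by (rule that)
qed

text \<open>Here locality enters: the maximal ideals above two proper ideals coincide, and this
  common ideal, closed under addition, absorbs the sum.\<close>

lemma (in local_cring) ideal_sum_eq_carrierD: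
  assumes "ideal I R" "ideal J R" "I <+> J = carrier R"
  shows "\<one> \<in> I \<or> \<one> \<in> J"
proof (rule ccontr)
  assume "\<not> ?thesis"
  then have "\<one> \<notin> I" "\<one> \<notin> J"
    by blast+
  then obtain M N where M: "maximalideal M R" "I \<subseteq> M" and N: "maximalideal N R" "J \<subseteq> N"
    using assms(1,2) by (elim proper_ideal_in_maximalideal)
  have "N = M"
    using unique_maximal_ideal M(1) N(1) by blast
  interpret maximalideal M R by fact
  have "I <+> J \<subseteq> M"
    using M(2) N(2) \<open>N = M\<close> by (auto simp: set_add_def')
  with assms(3) show False
    using I_notcarr a_subset by blast
qed

lemma mem_ideal_imp_iff:
  "x \<in> ideal_imp R I J \<longleftrightarrow> x \<in> carrier R \<and> (\<forall>i\<in>I. x \<otimes>\<^bsub>R\<^esub> i \<in> J)"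
  by (auto simp: ideal_imp_def l_coset_def)

text \<open>Serves both directions: the locality argument applies to sums of ideals, and a sum of
  ideals is all of \<open>R\<close> as soon as it contains \<open>\<one>\<close>. Each closure
  property is inherited from \<open>J\<close>.\<close>

lemma (in cring) ideal_imp_is_ideal:
  assumes "ideal I R" "ideal J R"
  shows "ideal (ideal_imp R I J) R"
proof -
  interpret I: ideal I R by fact
  interpret J: ideal J R by fact
  show ?thesis
  proof (rule idealI[OF ring_axioms])
    show "subgroup (ideal_imp R I J) (add_monoid R)"
    proof (rule add.subgroupI)
      show "ideal_imp R I J \<subseteq> carrier R"
        by (auto simp: mem_ideal_imp_iff)
      have "\<zero> \<in> ideal_imp R I J"
        by (simp add: mem_ideal_imp_iff)
      then show "ideal_imp R I J \<noteq> {}"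
        by blast
    qed (simp_all add: mem_ideal_imp_iff l_distr l_minus)
  next
    fix a x assume a: "a \<in> ideal_imp R I J" and x: "x \<in> carrier R"
    then show xa: "x \<otimes> a \<in> ideal_imp R I J"
      by (simp add: mem_ideal_imp_iff m_assoc J.I_l_closed)
    show "a \<otimes> x \<in> ideal_imp R I J"
      using a x xa by (simp add: mem_ideal_imp_iff m_comm)
  qed
qed

text \<open>Since \<open>\<one>\<close> fixes every element of \<open>I\<close>, comparability of
  ideals becomes a question of whether a residual contains the unit.\<close>

lemma (in cring) one_mem_ideal_imp_iff:
  assumes "I \<subseteq> carrier R"
  shows "\<one> \<in> ideal_imp R I J \<longleftrightarrow> I \<subseteq> J"
  using assms by (auto simp: mem_ideal_imp_iff subset_iff)

theorem proposition3p10: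
  fixes R :: "('a, 'b) ring_scheme" (structure)
  assumes "local_cring R"
  shows "mtl_ring R \<longleftrightarrow> chain_subset (ideals R)"
proof
  interpret local_cring R by fact
  assume "mtl_ring R"
  then interpret mtl_ring R .
  show "chain_subset (ideals R)"
    unfolding chain_subset_def
  proof (intro ballI)
    fix I J assume IJ: "I \<in> ideals R" "J \<in> ideals R"
    then have id: "ideal I R" "ideal J R"
      by (auto simp: ideals_def)
    then have "\<one> \<in> ideal_imp R I J \<or> \<one> \<in> ideal_imp R J I"
      by (intro ideal_sum_eq_carrierD ideal_imp_is_ideal mtl_prelinear IJ)
    then show "I \<subseteq> J \<or> J \<subseteq> I"
      using id by (simp add: one_mem_ideal_imp_iff ideal.Icarr subset_iff)
  qed
next
  interpret local_cring R by fact
  assume chain: "chain_subset (ideals R)"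
  show "mtl_ring R"
  proof unfold_locales
    fix x assume "x \<in> carrier R"
    then show "\<exists>r\<in>carrier R. x = r \<otimes> x"
      by (metis l_one one_closed)
  next
    fix I J assume IJ: "I \<in> ideals R" "J \<in> ideals R"
    then have id: "ideal I R" "ideal J R"
      by (auto simp: ideals_def)
    let ?A = "ideal_imp R I J" and ?B = "ideal_imp R J I"
    interpret A: ideal ?A R using id by (rule ideal_imp_is_ideal)
    interpret B: ideal ?B R using id(2,1) by (rule ideal_imp_is_ideal)
    interpret S: ideal "?A <+>\<^bsub>R\<^esub> ?B" R
      by (rule add_ideals) unfold_locales
    have "\<one> \<in> ?A \<or> \<one> \<in> ?B"
      using chain IJ id
      by (auto simp: chain_subset_def one_mem_ideal_imp_iff ideal.Icarr subset_iff)
    \<comment> \<open>One residual supplies \<open>\<one>\<close> and the other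
      \<open>\<zero>\<close>; keeping the sums unsimplified exhibits them as elements of the set
      sum.\<close>
    then have "\<one> \<oplus> \<zero> \<in> ?A <+> ?B \<or> \<zero> \<oplus> \<one> \<in> ?A <+> ?B"
      unfolding set_add_def' using A.zero_closed B.zero_closed by blast
    then show "?A <+> ?B = carrier R"
      using S.one_imp_carrier by simp
  qed
qed

end
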